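(* Let $\Gamma$ be a finite abelian group of order $w$, let $k\ge 2$ be an integer with $\gcd(w,k)=1$, and let $H=(V,\mathcal{E})$ be a $k$-uniform hypergraph that is $\mathscr{T}$-connected. If $H$ is strongly (respectively, weakly) $w$-colorable, then there is a weighting $\phi:\mathcal{E}\to\Gamma$ such that the induced vertex coloring $v\mapsto \sum_{E\in\mathcal{E},\, v\in E}\phi(E)$ is a strong (respectively, weak) vertex coloring of $H$.
   Context: A vertex coloring of a $k$-uniform hypergraph $H$ is weak if no edge is monochromatic, and strong if within each edge all vertices receive distinct colors. $H$ is strongly (weakly) $w$-colorable if it has a strong (weak) vertex coloring using at most $w$ colors. For distinct vertices $u,v$, a $1$-offset $uv$-trail is a sequence of edges $E_1,E_2,\dots,E_t$ of $H$ (vertices may appear in several of these edges) such that the consecutive intersections alternate in size, $|E_1\cap E_2|=k-1$, $|E_2\cap E_3|=1$, $|E_3\cap E_4|=k-1$, and so on, ending with $|E_{t-1}\cap E_t|=k-1$ (so $t$ is even), and moreover $u\in E_1\setminus E_2$ and $v\in E_t\setminus E_{t-1}$; thus the vertices along the trail are subdivided into alternating groups of sizes $1$ and $k-1$, starting with $\{u\}$ and ending with $\{v\}$. $H$ is $\mathscr{T}$-connected if for every pair of distinct vertices $u,v\in V$ there exists a $1$-offset $uv$-trail in $H$.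
   Formalization: A 1-offset trail is required to have the stated subdivision into groups {u}, k−1, 1, …, k−1, {v}, with each edge the union of two consecutive groups; this does not follow from the intersection sizes alone, and with sizes alone the theorem is false (e.g. k=3, w=2, weak case). *)

theory Defs
  imports Main
begin

definition uniform_hypergraph :: "nat \<Rightarrow> 'a set \<Rightarrow> 'a set set \<Rightarrow> bool" where
  "uniform_hypergraph k V \<E> \<longleftrightarrow> finite V \<and> (\<forall>e\<in>\<E>. e \<subseteq> V \<and> card e = k)"

definition weak_coloring :: "'a set set \<Rightarrow> ('a \<Rightarrow> 'c) \<Rightarrow> bool" where
  "weak_coloring \<E> c \<longleftrightarrow> (\<forall>e\<in>\<E>. \<not> (\<exists>a. \<forall>v\<in>e. c v = a))"

definition strong_coloring :: "'a set set \<Rightarrow> ('a \<Rightarrow> 'c) \<Rightarrow> bool" where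
  "strong_coloring \<E> c \<longleftrightarrow> (\<forall>e\<in>\<E>. inj_on c e)"

definition weakly_colorable :: "'a set \<Rightarrow> 'a set set \<Rightarrow> nat \<Rightarrow> bool" where
  "weakly_colorable V \<E> w \<longleftrightarrow> (\<exists>c :: 'a \<Rightarrow> nat. card (c ` V) \<le> w \<and> weak_coloring \<E> c)"

definition strongly_colorable :: "'a set \<Rightarrow> 'a set set \<Rightarrow> nat \<Rightarrow> bool" where
  "strongly_colorable V \<E> w \<longleftrightarrow> (\<exists>c :: 'a \<Rightarrow> nat. card (c ` V) \<le> w \<and> strong_coloring \<E> c)"

text \<open>
  The edge \<open>E\<^sub>i\<close> of a trail is \<open>es ! (i - 1)\<close>. The last conjunct is the subdivision of the trail into
  groups \<open>{x 0}, A 0, {x 1}, A 1, \<dots>\<close>, each edge being the union of two consecutive groups. It does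
  not follow from the intersection sizes: these alone would allow the common vertex of \<open>E\<^sub>2\<close> and
  \<open>E\<^sub>3\<close> to lie in \<open>E\<^sub>1 \<inter> E\<^sub>2\<close>.
\<close>

definition one_offset_trail :: "nat \<Rightarrow> 'a set set \<Rightarrow> 'a \<Rightarrow> 'a \<Rightarrow> 'a set list \<Rightarrow> bool" where
  "one_offset_trail k \<E> u v es \<longleftrightarrow>
     set es \<subseteq> \<E> \<and> es \<noteq> [] \<and> even (length es) \<and>
     (\<forall>i. Suc i < length es \<longrightarrow>
        card (es ! i \<inter> es ! Suc i) = (if even i then k - 1 else 1)) \<and>
     u \<in> es ! 0 - es ! 1 \<and>
     v \<in> es ! (length es - 1) - es ! (length es - 2) \<and>
     (\<exists>(x :: nat \<Rightarrow> 'a) (A :: nat \<Rightarrow> 'a set).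
        x 0 = u \<and> x (length es div 2) = v \<and>
        (\<forall>i < length es div 2.
           card (A i) = k - 1 \<and>
           es ! (2 * i) = {x i} \<union> A i \<and>
           es ! (2 * i + 1) = A i \<union> {x (i + 1)}))"

definition T_connected :: "nat \<Rightarrow> 'a set \<Rightarrow> 'a set set \<Rightarrow> bool" where
  "T_connected k V \<E> \<longleftrightarrow>
     (\<forall>u\<in>V. \<forall>v\<in>V. u \<noteq> v \<longrightarrow> (\<exists>es. one_offset_trail k \<E> u v es))"

definition induced_coloring :: "'a set set \<Rightarrow> ('a set \<Rightarrow> 'g) \<Rightarrow> 'a \<Rightarrow> 'g::comm_monoid_add" where
  "induced_coloring \<E> \<phi> v = (\<Sum>e | e \<in> \<E> \<and> v \<in> e. \<phi> e)"

end

theory Submission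
  imports Defs
begin

text \<open>
  If \<open>E\<^sub>1 = {x} \<union> A\<close> and \<open>E\<^sub>2 = A \<union> {y}\<close> are edges, weighting \<open>E\<^sub>1\<close> by \<open>g\<close> and \<open>E\<^sub>2\<close> by \<open>-g\<close> moves \<open>g\<close>
  from \<open>y\<close> to \<open>x\<close> and changes no other vertex; telescoping along a trail moves \<open>g\<close> between any two
  vertices. So every vertex labelling with total \<open>0\<close> is induced by some weighting. One edge weighted
  by \<open>t\<close> contributes \<open>k \<cdot> t\<close> to the total, and multiplication by \<open>k\<close> is surjective on \<open>\<Gamma>\<close> because
  \<open>gcd w k = 1\<close>; hence every labelling, in particular any given \<open>w\<close>-coloring with colors renamed to
  elements of \<open>\<Gamma>\<close>, is induced.
\<close>

text \<open>In an abstract commutative monoid the multiple n \<cdot> g is expressed as a constant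
  sum over an n-element set; this makes the choice of the set irrelevant.\<close>

lemma sum_const_card_cong:
  fixes g :: "'g::comm_monoid_add"
  assumes "finite A" "finite B" "card A = card B"
  shows "(\<Sum>_\<in>A. g) = (\<Sum>_\<in>B. g)"
proof -
  obtain h where "bij_betw h A B"
    using finite_same_card_bij[OF assms] by blast
  then show ?thesis by (rule sum.reindex_bij_betw)
qed

text \<open>Translation by \<open>g\<close> permutes the group, so adding \<open>g\<close> to every
  element leaves the sum of all elements unchanged; cancel that sum.\<close>

lemma sum_UNIV_const_eq_0:
  fixes g :: "'g::{ab_group_add,finite}"
  shows "(\<Sum>_\<in>(UNIV :: 'g set). g) = 0"
proof -
  have "(\<Sum>x\<in>(UNIV :: 'g set). x + g) = (\<Sum>x\<in>(UNIV :: 'g set). x)"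
    by (rule sum.reindex_bij_betw[where g = "\<lambda>x. x"])
      (auto simp: bij_betw_def inj_on_def intro: image_eqI[where x = "y - g" for y])
  then show ?thesis by (simp add: sum.distrib)
qed

text \<open>Bezout: if k \<cdot> a = w \<cdot> b + 1, then t = a \<cdot> s satisfies k \<cdot> t = b
  \<cdot> (w \<cdot> s) + s = s, since w \<cdot> s = 0.\<close>

lemma sum_const_surj_if_coprime:
  fixes s :: "'g::{ab_group_add,finite}"
  assumes "finite e" "e \<noteq> {}" and cop: "coprime (card e) (card (UNIV :: 'g set))"
  shows "\<exists>t. (\<Sum>_\<in>e. t) = s"
proof -
  define w where "w = card (UNIV :: 'g set)"
  obtain a b where ab: "card e * a = w * b + 1"
    using bezout_nat[of "card e" w] assms unfolding w_def coprime_iff_gcd_eq_1 by auto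
  have "(\<Sum>_\<in>e. \<Sum>_<a. s) = (\<Sum>_\<in>e \<times> {..<a}. s)"
    by (simp add: sum.cartesian_product)
  also have "\<dots> = (\<Sum>_<Suc (w * b). s)"
    by (rule sum_const_card_cong) (use assms ab in \<open>auto simp: card_cartesian_product\<close>)
  also have "\<dots> = (\<Sum>_<w * b. s) + s" by simp
  \<comment> \<open>Group the \<open>w * b\<close> summands into \<open>b\<close> blocks indexed by
    the whole group, each of which vanishes.\<close>
  also have "(\<Sum>_<w * b. s) = (\<Sum>_\<in>{..<b} \<times> (UNIV :: 'g set). s)"
    by (rule sum_const_card_cong) (auto simp: card_cartesian_product w_def)
  also have "\<dots> = (\<Sum>_<b. \<Sum>_\<in>(UNIV :: 'g set). s)"
    by (simp add: sum.cartesian_product)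
  also have "\<dots> = 0" by (simp add: sum_UNIV_const_eq_0)
  finally show ?thesis by auto
qed

lemma induced_coloring_add:
  "induced_coloring \<E> (\<lambda>e. \<phi> e + \<psi> e) v = induced_coloring \<E> \<phi> v + induced_coloring \<E> \<psi> v"
  by (simp add: induced_coloring_def sum.distrib)

lemma induced_coloring_sum:
  "induced_coloring \<E> (\<lambda>e. \<Sum>i\<in>I. \<phi> i e) v = (\<Sum>i\<in>I. induced_coloring \<E> (\<phi> i) v)"
  unfolding induced_coloring_def by (rule sum.swap)

lemma induced_coloring_single:
  assumes "finite \<E>" "e \<in> \<E>"
  shows "induced_coloring \<E> (\<lambda>e'. if e' = e then g else 0) v = (if v \<in> e then g else 0)"
  using assms by (simp add: induced_coloring_def sum.delta)

lemma transfer_along_trail: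
  fixes g :: "'g::ab_group_add"
  assumes H: "uniform_hypergraph k V \<E>" and fin: "finite \<E>" and k: "k \<ge> 2"
    and trail: "one_offset_trail k \<E> u v es"
  shows "\<exists>\<phi>. \<forall>z. induced_coloring \<E> \<phi> z = (if z = u then g else 0) - (if z = v then g else 0)"
proof -
  define n where "n = length es div 2"
  obtain x A where x: "x 0 = u" "x n = v"
    and A: "\<And>i. i < n \<Longrightarrow> card (A i) = k - 1 \<and> es ! (2 * i) = {x i} \<union> A i \<and>
              es ! (2 * i + 1) = A i \<union> {x (i + 1)}"
    using trail unfolding one_offset_trail_def n_def by blast
  \<comment> \<open>A sum of two single-edge weightings, so that the lemmas on induced colorings
    evaluate it directly.\<close>
  define \<phi> where "\<phi> i e = (if e = es ! (2 * i) then g else 0) +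
    (if e = es ! (2 * i + 1) then - g else 0)" for i e
  have step: "induced_coloring \<E> (\<phi> i) z =
      (if z = x i then g else 0) - (if z = x (Suc i) then g else 0)" if i: "i < n" for i z
  proof -
    have len: "2 * i < length es" "2 * i + 1 < length es"
      using i by (auto simp: n_def)
    moreover have "set es \<subseteq> \<E>" using trail by (simp add: one_offset_trail_def)
    ultimately have mem: "es ! (2 * i) \<in> \<E>" "es ! (2 * i + 1) \<in> \<E>"
      using nth_mem by blast+
    then have card: "card (insert (x i) (A i)) = k" "card (insert (x (Suc i)) (A i)) = k"
      using H A[OF i] by (auto simp: uniform_hypergraph_def)
    \<comment> \<open>If an endpoint lay in \<open>A i\<close>, its edge would be \<open>A i\<close>
      itself, of size \<open>k - 1\<close>. So \<open>g\<close> and \<open>- g\<close> meet exactly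
      on \<open>A i\<close> and cancel there.\<close>
    have "card (A i) \<noteq> k" using A[OF i] k by simp
    then have "x i \<notin> A i" "x (Suc i) \<notin> A i"
      using card by (metis insert_absorb)+
    then show ?thesis
      unfolding \<phi>_def induced_coloring_add induced_coloring_single[OF fin mem(1)]
        induced_coloring_single[OF fin mem(2)]
      by (simp add: A[OF i, THEN conjunct2, simplified])
  qed
  \<comment> \<open>Summing over \<open>i\<close> lets weights accumulate on an edge that recurs in
    the trail.\<close>
  have "induced_coloring \<E> (\<lambda>e. \<Sum>i<n. \<phi> i e) z =
      (if z = u then g else 0) - (if z = v then g else 0)" for z
    using sum_lessThan_telescope'[of "\<lambda>i. if z = x i then g else 0" n] x
    by (simp add: induced_coloring_sum step)
  then show ?thesis by blast
qed

text \<open>A root \<open>r\<close> serves as the source: move \<open>f u\<close> from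
  \<open>r\<close> to each other vertex \<open>u\<close>. Then \<open>r\<close> is left with minus
  the sum of the other labels, which is \<open>f r\<close> because the total is zero.\<close>

lemma zero_sum_labelling_induced:
  fixes f :: "'a \<Rightarrow> 'g::ab_group_add"
  assumes H: "uniform_hypergraph k V \<E>" and fin: "finite \<E>" and k: "k \<ge> 2"
    and conn: "T_connected k V \<E>" and f: "sum f V = 0"
  shows "\<exists>\<phi>. \<forall>v\<in>V. induced_coloring \<E> \<phi> v = f v"
proof (cases "V = {}")
  case False
  then obtain r where r: "r \<in> V" by blast
  have finV: "finite V" using H by (simp add: uniform_hypergraph_def)
  have "\<forall>u\<in>V - {r}. \<exists>\<phi>. \<forall>z. induced_coloring \<E> \<phi> z =
      (if z = u then f u else 0) - (if z = r then f u else 0)"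
    using conn r transfer_along_trail[OF H fin k] unfolding T_connected_def by blast
  then obtain \<Phi> where \<Phi>: "\<And>u z. u \<in> V - {r} \<Longrightarrow> induced_coloring \<E> (\<Phi> u) z =
      (if z = u then f u else 0) - (if z = r then f u else 0)"
    by metis
  have "induced_coloring \<E> (\<lambda>e. \<Sum>u\<in>V - {r}. \<Phi> u e) z = f z" if z: "z \<in> V" for z
  proof -
    have "induced_coloring \<E> (\<lambda>e. \<Sum>u\<in>V - {r}. \<Phi> u e) z =
        (\<Sum>u\<in>V - {r}. if z = u then f u else 0) - (\<Sum>u\<in>V - {r}. if z = r then f u else 0)"
      by (simp add: induced_coloring_sum \<Phi> sum_subtractf)
    moreover have "sum f (V - {r}) = - f r"
      using f sum.remove[OF finV r, of f] by (simp add: eq_neg_iff_add_eq_0 add.commute)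
    ultimately show ?thesis
      using z finV by (cases "z = r") (auto simp: sum.delta')
  qed
  then show ?thesis by blast
qed auto

text \<open>Nonemptiness of \<open>\<E>\<close> supplies the edge whose weight accounts for the
  total of \<open>f\<close>; without edges only the zero labelling is induced.\<close>

lemma labelling_induced:
  fixes f :: "'a \<Rightarrow> 'g::{ab_group_add,finite}"
  assumes H: "uniform_hypergraph k V \<E>" and k: "k \<ge> 2"
    and conn: "T_connected k V \<E>" and cop: "coprime k (card (UNIV :: 'g set))"
    and ne: "\<E> \<noteq> {}"
  shows "\<exists>\<phi>. \<forall>v\<in>V. induced_coloring \<E> \<phi> v = f v"
proof -
  have finV: "finite V" using H by (simp add: uniform_hypergraph_def)
  have fin: "finite \<E>"
    by (rule finite_subset[of _ "Pow V"]) (use H in \<open>auto simp: uniform_hypergraph_def\<close>)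
  obtain e where e: "e \<in> \<E>" using ne by blast
  then have eV: "e \<subseteq> V" and ck: "card e = k" using H by (auto simp: uniform_hypergraph_def)
  have fe: "finite e" using eV finV finite_subset by blast
  have "e \<noteq> {}" using ck k by auto
  then obtain t :: 'g where t: "(\<Sum>_\<in>e. t) = sum f V"
    using sum_const_surj_if_coprime[OF fe] cop ck by metis
  have "(\<Sum>v\<in>V. if v \<in> e then t else 0) = (\<Sum>_\<in>e. t)"
    using finV eV by (simp add: sum.If_cases Int_absorb1)
  then have "(\<Sum>v\<in>V. f v - (if v \<in> e then t else 0)) = 0"
    by (simp add: sum_subtractf t)
  from zero_sum_labelling_induced[OF H fin k conn this]
  obtain \<phi> where "\<forall>v\<in>V. induced_coloring \<E> \<phi> v = f v - (if v \<in> e then t else 0)" by blast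
  then have "\<forall>v\<in>V. induced_coloring \<E> (\<lambda>e'. \<phi> e' + (if e' = e then t else 0)) v = f v"
    unfolding induced_coloring_add induced_coloring_single[OF fin e] by simp
  then show ?thesis by blast
qed

theorem theorem6:
  fixes V :: "'a set" and \<E> :: "'a set set" and k w :: nat
  assumes "card (UNIV :: 'g::{ab_group_add,finite} set) = w"
    and "k \<ge> 2"
    and "gcd w k = 1"
    and "uniform_hypergraph k V \<E>"
    and "T_connected k V \<E>"
  shows "(strongly_colorable V \<E> w \<longrightarrow>
            (\<exists>\<phi> :: 'a set \<Rightarrow> 'g. strong_coloring \<E> (induced_coloring \<E> \<phi>))) \<and>
         (weakly_colorable V \<E> w \<longrightarrow>
            (\<exists>\<phi> :: 'a set \<Rightarrow> 'g. weak_coloring \<E> (induced_coloring \<E> \<phi>)))"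
proof (cases "\<E> = {}")
  case True
  then show ?thesis by (simp add: strong_coloring_def weak_coloring_def)
next
  case False
  have finV: "finite V" and edge: "\<And>e. e \<in> \<E> \<Longrightarrow> e \<subseteq> V \<and> e \<noteq> {}"
    using assms(2,4) by (auto simp: uniform_hypergraph_def)
  have cop: "coprime k (card (UNIV :: 'g set))"
    using assms(1,3) by (simp add: coprime_iff_gcd_eq_1 gcd.commute)
  \<comment> \<open>Both kinds of coloring depend only on which vertices share a color, so it
    suffices to reproduce this relation. The at most \<open>w\<close> colors inject into the group
    of order \<open>w\<close>.\<close>
  have recolor: "\<exists>\<phi> :: 'a set \<Rightarrow> 'g. \<forall>x\<in>V. \<forall>y\<in>V.
      induced_coloring \<E> \<phi> x = induced_coloring \<E> \<phi> y \<longleftrightarrow> c x = c y"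
    if card_c: "card (c ` V) \<le> w" for c :: "'a \<Rightarrow> nat"
  proof -
    obtain h :: "nat \<Rightarrow> 'g" where h: "inj_on h (c ` V)"
      using card_le_inj[of "c ` V" "UNIV :: 'g set"] finV card_c assms(1) by auto
    obtain \<phi> where "\<forall>v\<in>V. induced_coloring \<E> \<phi> v = h (c v)"
      using labelling_induced[OF assms(4,2,5) cop False, of "h \<circ> c"] by auto
    with h have "\<forall>x\<in>V. \<forall>y\<in>V. induced_coloring \<E> \<phi> x = induced_coloring \<E> \<phi> y \<longleftrightarrow> c x = c y"
      by (simp add: inj_on_eq_iff)
    then show ?thesis by blast
  qed
  show ?thesis
  proof (intro conjI impI)
    assume "strongly_colorable V \<E> w"
    then obtain c :: "'a \<Rightarrow> nat" where "card (c ` V) \<le> w" and c: "strong_coloring \<E> c"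
      by (auto simp: strongly_colorable_def)
    from recolor[OF this(1)] obtain \<phi> :: "'a set \<Rightarrow> 'g"
      where \<phi>: "\<forall>x\<in>V. \<forall>y\<in>V. induced_coloring \<E> \<phi> x = induced_coloring \<E> \<phi> y \<longleftrightarrow> c x = c y" by blast
    have "inj_on (induced_coloring \<E> \<phi>) e" if e: "e \<in> \<E>" for e
    proof (rule inj_onI)
      fix x y assume "x \<in> e" "y \<in> e" "induced_coloring \<E> \<phi> x = induced_coloring \<E> \<phi> y"
      moreover from this have "c x = c y" using \<phi> edge[OF e] by blast
      ultimately show "x = y" using c e by (auto simp: strong_coloring_def dest: inj_onD)
    qed
    then show "\<exists>\<phi> :: 'a set \<Rightarrow> 'g. strong_coloring \<E> (induced_coloring \<E> \<phi>)"
      unfolding strong_coloring_def by blast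
  next
    assume "weakly_colorable V \<E> w"
    then obtain c :: "'a \<Rightarrow> nat" where "card (c ` V) \<le> w" and c: "weak_coloring \<E> c"
      by (auto simp: weakly_colorable_def)
    from recolor[OF this(1)] obtain \<phi> :: "'a set \<Rightarrow> 'g"
      where \<phi>: "\<forall>x\<in>V. \<forall>y\<in>V. induced_coloring \<E> \<phi> x = induced_coloring \<E> \<phi> y \<longleftrightarrow> c x = c y" by blast
    have False if e: "e \<in> \<E>" and a: "\<forall>v\<in>e. induced_coloring \<E> \<phi> v = a" for e a
    proof -
      \<comment> \<open>Any vertex of the edge names the single color \<open>c x\<close> that
        \<open>c\<close> would have on it.\<close>
      obtain x where x: "x \<in> e" using edge[OF e] by blast
      have "c v = c x" if "v \<in> e" for v
      proof -
        have "v \<in> V" "x \<in> V" using edge[OF e] x that by auto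
        moreover have "induced_coloring \<E> \<phi> v = induced_coloring \<E> \<phi> x" using a x that by simp
        ultimately show ?thesis using \<phi> by blast
      qed
      then show False using c e unfolding weak_coloring_def by blast
    qed
    then show "\<exists>\<phi> :: 'a set \<Rightarrow> 'g. weak_coloring \<E> (induced_coloring \<E> \<phi>)"
      unfolding weak_coloring_def by blast
  qed
qed

end
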